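(* Let $p$ be a prime, $q$ a power of $p$, and let $\rho$ be a permutation of the set $\{0,1,2,\dots\}$ with associated map $\rho_\ast:\mathbb{Z}_p\to\mathbb{Z}_p$ obtained by permuting $q$-adic digits. Then: 1. The mapping $x\mapsto\rho_\ast(x)$ is continuous on $\mathbb{Z}_p$. 2. If $x,y,z\in\mathbb{Z}_p$ satisfy $z=x+y$ and there is no carry over of $q$-adic digits in this sum, then $\rho_\ast(z)=\rho_\ast(x)+\rho_\ast(y)$. 3. The mapping $\rho_\ast$ stabilizes (setwise) the nonnegative integers. 4. The mapping $\rho_\ast$ stabilizes (setwise) the negative integers. 5. If $n$ is a nonnegative integer, then $\ell_q(n)=\ell_q(\rho_\ast(n))$. 6. If $n$ is an integer, then $n\equiv\rho_\ast(n)\pmod{q-1}$.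
   Context: Every $x\in\mathbb{Z}_p$ is written uniquely $q$-adically as $x=\sum_{i=0}^\infty c_iq^i$ with integers $0\le c_i<q$ (the $q$-adic digits). Define $\rho_\ast(x):=\sum_{i=0}^\infty c_iq^{\rho(i)}$. For a nonnegative integer $x=\sum_i c_iq^i$ set $\ell_q(x):=\sum_i c_i$. "No carry over of $q$-adic digits" in $x+y$ means that for every $i$ the sum of the $i$-th $q$-adic digits of $x$ and $y$ is at most $q-1$. Integers are regarded as elements of $\mathbb{Z}_p$. *)

theory Defs
  imports "HOL-Analysis.Analysis" "HOL-Algebra.Ring" "HOL-Number_Theory.Cong"
begin

text \<open>
  The ring of \<open>p\<close>-adic integers as the inverse limit of the rings of residues modulo \<open>p ^ n\<close>:
  \<open>x n\<close> is the residue of \<open>x\<close> modulo \<open>p ^ n\<close>, represented in \<open>{0..<p ^ n}\<close>.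
\<close>

definition Zp :: "int \<Rightarrow> (nat \<Rightarrow> int) ring" where
  "Zp p = \<lparr>
     carrier = {x. \<forall>n. x n \<in> {0..<p ^ n} \<and> x (Suc n) mod p ^ n = x n},
     mult = (\<lambda>x y n. (x n * y n) mod p ^ n),
     one = (\<lambda>n. 1 mod p ^ n),
     zero = (\<lambda>n. 0),
     add = (\<lambda>x y n. (x n + y n) mod p ^ n)\<rparr>"

definition Zp_of_int :: "int \<Rightarrow> int \<Rightarrow> (nat \<Rightarrow> int)" where
  "Zp_of_int p a = (\<lambda>n. a mod p ^ n)"

definition Zp_topology :: "int \<Rightarrow> (nat \<Rightarrow> int) topology" where
  "Zp_topology p =
     subtopology (product_topology (\<lambda>n. discrete_topology {0..<p ^ n}) UNIV) (carrier (Zp p))"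

text \<open>
  Convergence in \<open>Zp p\<close> of a series of integers; its partial sums are integers, so the ring
  operations of \<open>Zp p\<close> are not needed to form them.
\<close>

definition Zp_sums :: "int \<Rightarrow> (nat \<Rightarrow> int) \<Rightarrow> (nat \<Rightarrow> int) \<Rightarrow> bool" where
  "Zp_sums p a x \<longleftrightarrow>
     limitin (Zp_topology p) (\<lambda>n. Zp_of_int p (\<Sum>i<n. a i)) x sequentially"

definition Zp_suminf :: "int \<Rightarrow> (nat \<Rightarrow> int) \<Rightarrow> (nat \<Rightarrow> int)" where
  "Zp_suminf p a = (THE x. Zp_sums p a x)"

definition qdigits :: "int \<Rightarrow> int \<Rightarrow> (nat \<Rightarrow> int) \<Rightarrow> (nat \<Rightarrow> int)" where
  "qdigits p q x = (THE c. (\<forall>i. 0 \<le> c i \<and> c i < q) \<and> Zp_sums p (\<lambda>i. c i * q ^ i) x)"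

definition rho_star :: "int \<Rightarrow> int \<Rightarrow> (nat \<Rightarrow> nat) \<Rightarrow> (nat \<Rightarrow> int) \<Rightarrow> (nat \<Rightarrow> int)" where
  "rho_star p q \<rho> x = Zp_suminf p (\<lambda>i. qdigits p q x i * q ^ \<rho> i)"

definition no_carry :: "int \<Rightarrow> int \<Rightarrow> (nat \<Rightarrow> int) \<Rightarrow> (nat \<Rightarrow> int) \<Rightarrow> bool" where
  "no_carry p q x y \<longleftrightarrow> (\<forall>i. qdigits p q x i + qdigits p q y i \<le> q - 1)"

text \<open>
  A nonnegative integer has only finitely many nonzero digits, so the sum below is over a
  finite set.
\<close>

definition digit_sum :: "int \<Rightarrow> int \<Rightarrow> nat \<Rightarrow> int" where
  "digit_sum p q n =
     (\<Sum>i | qdigits p q (Zp_of_int p (int n)) i \<noteq> 0. qdigits p q (Zp_of_int p (int n)) i)"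


text \<open>
  The remaining facts show that the definitions above are meaningful: \<open>Zp p\<close> is a commutative
  ring containing the integers, and the two definite descriptions denote.
\<close>

lemma Zp_simps [simp]:
  "x \<oplus>\<^bsub>Zp p\<^esub> y = (\<lambda>n. (x n + y n) mod p ^ n)"
  "x \<otimes>\<^bsub>Zp p\<^esub> y = (\<lambda>n. (x n * y n) mod p ^ n)"
  "\<one>\<^bsub>Zp p\<^esub> = (\<lambda>n. 1 mod p ^ n)"
  "\<zero>\<^bsub>Zp p\<^esub> = (\<lambda>n. 0)"
  by (simp_all add: Zp_def)

lemma carrier_Zp:
  "x \<in> carrier (Zp p) \<longleftrightarrow> (\<forall>n. 0 \<le> x n \<and> x n < p ^ n \<and> x (Suc n) mod p ^ n = x n)"
  by (auto simp: Zp_def)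

lemma Zp_mod_self: "x \<in> carrier (Zp p) \<Longrightarrow> x n mod p ^ n = x n"
  by (simp add: carrier_Zp)

lemma Zp_mod_le:
  assumes x: "x \<in> carrier (Zp p)" and "m \<le> n"
  shows "x n mod p ^ m = x m"
  using \<open>m \<le> n\<close>
proof (induction n rule: dec_induct)
  case base
  show ?case using Zp_mod_self[OF x] .
next
  case (step n)
  have "x (Suc n) mod p ^ m = x (Suc n) mod p ^ n mod p ^ m"
    using step.hyps by (simp add: le_imp_power_dvd mod_mod_cancel)
  also have "x (Suc n) mod p ^ n = x n"
    using x by (simp add: carrier_Zp)
  finally show ?case using step.IH by simp
qed

lemma Zp_of_int_closed [simp]:
  assumes "p > 0"
  shows "Zp_of_int p a \<in> carrier (Zp p)"
  using assms by (auto simp: carrier_Zp Zp_of_int_def mod_mod_cancel)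

lemma Zp_memI:
  assumes "p > 0" "\<And>n. f (Suc n) mod p ^ n = f n mod p ^ n"
  shows "(\<lambda>n. f n mod p ^ n) \<in> carrier (Zp p)"
  using assms by (auto simp: carrier_Zp mod_mod_cancel)

lemma Zp_Suc: "x \<in> carrier (Zp p) \<Longrightarrow> x (Suc n) mod p ^ n = x n"
  by (simp add: carrier_Zp)

lemma cring_Zp:
  assumes p: "p > 0"
  shows "cring (Zp p)"
proof (rule cringI)
  show "abelian_group (Zp p)"
  proof (rule abelian_groupI)
    fix x y assume x: "x \<in> carrier (Zp p)" and y: "y \<in> carrier (Zp p)"
    have "(x (Suc n) + y (Suc n)) mod p ^ n = (x n + y n) mod p ^ n" for n
      by (metis Zp_Suc x y mod_add_eq)
    then show "x \<oplus>\<^bsub>Zp p\<^esub> y \<in> carrier (Zp p)"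
      unfolding Zp_simps by (rule Zp_memI[OF p])
  next
    show "\<zero>\<^bsub>Zp p\<^esub> \<in> carrier (Zp p)"
      using p by (simp add: carrier_Zp)
  next
    fix x y z
    show "x \<oplus>\<^bsub>Zp p\<^esub> y \<oplus>\<^bsub>Zp p\<^esub> z = x \<oplus>\<^bsub>Zp p\<^esub> (y \<oplus>\<^bsub>Zp p\<^esub> z)"
      by (simp add: mod_simps add.assoc)
    show "x \<oplus>\<^bsub>Zp p\<^esub> y = y \<oplus>\<^bsub>Zp p\<^esub> x"
      by (simp add: add.commute)
  next
    fix x assume x: "x \<in> carrier (Zp p)"
    show "\<zero>\<^bsub>Zp p\<^esub> \<oplus>\<^bsub>Zp p\<^esub> x = x"
      using Zp_mod_self[OF x] by simp
    have "(- x (Suc n)) mod p ^ n = (- x n) mod p ^ n" for n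
      by (metis Zp_Suc x mod_minus_eq)
    then have "(\<lambda>n. (- x n) mod p ^ n) \<in> carrier (Zp p)"
      by (rule Zp_memI[OF p])
    moreover have "(\<lambda>n. (- x n) mod p ^ n) \<oplus>\<^bsub>Zp p\<^esub> x = \<zero>\<^bsub>Zp p\<^esub>"
      by (simp add: mod_simps)
    ultimately show "\<exists>y\<in>carrier (Zp p). y \<oplus>\<^bsub>Zp p\<^esub> x = \<zero>\<^bsub>Zp p\<^esub>"
      by blast
  qed
next
  show "comm_monoid (Zp p)"
  proof (rule comm_monoidI)
    fix x y assume x: "x \<in> carrier (Zp p)" and y: "y \<in> carrier (Zp p)"
    have "(x (Suc n) * y (Suc n)) mod p ^ n = (x n * y n) mod p ^ n" for n
      by (metis Zp_Suc x y mod_mult_eq)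
    then show "x \<otimes>\<^bsub>Zp p\<^esub> y \<in> carrier (Zp p)"
      unfolding Zp_simps by (rule Zp_memI[OF p])
  next
    show "\<one>\<^bsub>Zp p\<^esub> \<in> carrier (Zp p)"
      using Zp_of_int_closed[OF p, of 1] by (simp add: Zp_of_int_def)
  next
    fix x y z
    show "x \<otimes>\<^bsub>Zp p\<^esub> y \<otimes>\<^bsub>Zp p\<^esub> z = x \<otimes>\<^bsub>Zp p\<^esub> (y \<otimes>\<^bsub>Zp p\<^esub> z)"
      by (simp add: mod_simps mult.assoc)
    show "x \<otimes>\<^bsub>Zp p\<^esub> y = y \<otimes>\<^bsub>Zp p\<^esub> x"
      by (simp add: mult.commute)
  next
    fix x assume x: "x \<in> carrier (Zp p)"
    show "\<one>\<^bsub>Zp p\<^esub> \<otimes>\<^bsub>Zp p\<^esub> x = x"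
      using Zp_mod_self[OF x] by (simp add: mod_simps)
  qed
next
  fix x y z
  show "(x \<oplus>\<^bsub>Zp p\<^esub> y) \<otimes>\<^bsub>Zp p\<^esub> z = x \<otimes>\<^bsub>Zp p\<^esub> z \<oplus>\<^bsub>Zp p\<^esub> y \<otimes>\<^bsub>Zp p\<^esub> z"
    by (simp add: mod_simps distrib_right)
qed

lemma Zp_of_int_add: "Zp_of_int p (a + b) = Zp_of_int p a \<oplus>\<^bsub>Zp p\<^esub> Zp_of_int p b"
  by (simp add: Zp_of_int_def mod_simps)

lemma Zp_of_int_mult: "Zp_of_int p (a * b) = Zp_of_int p a \<otimes>\<^bsub>Zp p\<^esub> Zp_of_int p b"
  by (simp add: Zp_of_int_def mod_simps)

lemma Zp_of_int_one: "Zp_of_int p 1 = \<one>\<^bsub>Zp p\<^esub>"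
  by (simp add: Zp_of_int_def)

lemma inj_Zp_of_int:
  assumes "p > 1"
  shows "inj (Zp_of_int p)"
proof (rule injI)
  fix a b assume eq: "Zp_of_int p a = Zp_of_int p b"
  have less: "int n < p ^ n" for n
  proof -
    have "int n < 2 ^ n"
      by (metis of_nat_less_two_power)
    also have "\<dots> \<le> p ^ n"
      using assms by (intro power_mono) auto
    finally show ?thesis .
  qed
  define n where "n = nat \<bar>a - b\<bar>"
  have "a mod p ^ n = b mod p ^ n"
    using fun_cong[OF eq, of n] by (simp add: Zp_of_int_def)
  then have "p ^ n dvd a - b"
    by (simp add: mod_eq_dvd_iff)
  moreover have "\<bar>a - b\<bar> < p ^ n"
    using less[of n] by (simp add: n_def)
  ultimately show "a = b"
    using dvd_imp_le_int[of "a - b" "p ^ n"] by fastforce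
qed

lemma topspace_Zp [simp]: "topspace (Zp_topology p) = carrier (Zp p)"
  by (auto simp: Zp_topology_def Zp_def PiE_UNIV_domain)

lemma limitin_Zp:
  assumes f: "\<And>i. f i \<in> carrier (Zp p)" and p: "p > 0"
  shows "limitin (Zp_topology p) f x F \<longleftrightarrow>
     x \<in> carrier (Zp p) \<and> (\<forall>n. \<forall>\<^sub>F i in F. f i n = x n)"
proof -
  have comp: "limitin (discrete_topology {0..<p ^ n}) (\<lambda>i. f i n) (x n) F \<longleftrightarrow>
       (\<forall>\<^sub>F i in F. f i n = x n)" if "x \<in> carrier (Zp p)" for n
    using that unfolding limitin_def
    by (force simp: carrier_Zp elim: eventually_mono
        dest: spec[of _ "{x n}"])
  show ?thesis
    unfolding Zp_topology_def limitin_subtopology limitin_componentwise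
    using f comp by (auto simp: PiE_UNIV_domain carrier_Zp)
qed

lemma Zp_sums_iff:
  assumes "p > 0"
  shows "Zp_sums p a x \<longleftrightarrow> x \<in> carrier (Zp p) \<and>
     (\<forall>n. \<forall>\<^sub>F m in sequentially. (\<Sum>i<m. a i) mod p ^ n = x n)"
  unfolding Zp_sums_def limitin_Zp[OF Zp_of_int_closed[OF assms] assms]
  by (simp add: Zp_of_int_def)

lemma Zp_sums_unique:
  assumes "p > 0" "Zp_sums p a x" "Zp_sums p a y"
  shows "x = y"
proof
  fix n
  have "\<forall>\<^sub>F m in sequentially. (\<Sum>i<m. a i) mod p ^ n = x n"
       "\<forall>\<^sub>F m in sequentially. (\<Sum>i<m. a i) mod p ^ n = y n"
    using assms by (simp_all add: Zp_sums_iff)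
  then have "\<forall>\<^sub>F m in sequentially. x n = y n"
    by eventually_elim simp
  then show "x n = y n" by simp
qed

lemma mod_add_dvd: "(a + b) mod n = a mod n" if "n dvd b" for a b n :: int
  using that by (auto elim: dvdE)

lemma Zp_sums_digits_iff:
  assumes p: "p > 1" and q: "q = p ^ k" "k \<ge> 1"
  shows "Zp_sums p (\<lambda>i. c i * q ^ i) x \<longleftrightarrow>
     x \<in> carrier (Zp p) \<and> (\<forall>m. x (k * m) = (\<Sum>i<m. c i * q ^ i) mod q ^ m)"
    (is "_ \<longleftrightarrow> _ \<and> ?R")
proof -
  have stable: "(\<Sum>i<m'. c i * q ^ i) mod q ^ m = (\<Sum>i<m. c i * q ^ i) mod q ^ m"
    if "m \<le> m'" for m m'
    using that
  proof (induction m' rule: dec_induct)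
    case (step m')
    have "q ^ m dvd c m' * q ^ m'"
      using step.hyps by (simp add: le_imp_power_dvd)
    then show ?case using step.IH by (simp add: mod_add_dvd)
  qed simp
  have qm: "q ^ m = p ^ (k * m)" for m
    by (simp add: q power_mult)
  have "(\<forall>n. \<forall>\<^sub>F m in sequentially. (\<Sum>i<m. c i * q ^ i) mod p ^ n = x n) \<longleftrightarrow> ?R"
    if x: "x \<in> carrier (Zp p)"
  proof (intro iffI allI)
    fix m
    assume *: "\<forall>n. \<forall>\<^sub>F m in sequentially. (\<Sum>i<m. c i * q ^ i) mod p ^ n = x n"
    have "\<forall>\<^sub>F m' in sequentially. (\<Sum>i<m'. c i * q ^ i) mod q ^ m = x (k * m) \<and> m \<le> m'"
      using *[rule_format, of "k * m"] eventually_ge_at_top[of m]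
      by eventually_elim (simp add: qm)
    then obtain m' where "(\<Sum>i<m'. c i * q ^ i) mod q ^ m = x (k * m)" "m \<le> m'"
      unfolding eventually_sequentially by blast
    then show "x (k * m) = (\<Sum>i<m. c i * q ^ i) mod q ^ m"
      using stable[OF \<open>m \<le> m'\<close>] by simp
  next
    fix n assume R: ?R
    show "\<forall>\<^sub>F m in sequentially. (\<Sum>i<m. c i * q ^ i) mod p ^ n = x n"
      using eventually_ge_at_top[of n]
    proof eventually_elim
      case (elim m)
      have le: "n \<le> k * m"
        using elim q(2) mult_le_mono[of 1 k n m] by simp
      have "x n = x (k * m) mod p ^ n"
        using Zp_mod_le[OF x le] by simp
      also have "\<dots> = (\<Sum>i<m. c i * q ^ i) mod p ^ n"
        using R le by (simp add: qm mod_mod_cancel le_imp_power_dvd)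
      finally show ?case by simp
    qed
  qed
  then show ?thesis using p by (auto simp: Zp_sums_iff)
qed

lemma qadic_expansion_ex1:
  assumes p: "p > 1" and q: "q = p ^ k" "k \<ge> 1" and x: "x \<in> carrier (Zp p)"
  shows "\<exists>!c. (\<forall>i. 0 \<le> c i \<and> c i < q) \<and> Zp_sums p (\<lambda>i. c i * q ^ i) x"
proof -
  have q0: "q > 0" using p q by simp
  have qm: "q ^ m = p ^ (k * m)" for m
    by (simp add: q power_mult)
  have bound: "0 \<le> (\<Sum>i<m. c i * q ^ i) \<and> (\<Sum>i<m. c i * q ^ i) < q ^ m"
    if c: "\<And>i. 0 \<le> c i \<and> c i < q" for c :: "nat \<Rightarrow> int" and m
  proof (induction m)
    case (Suc m)
    have "c m * q ^ m + q ^ m \<le> q * q ^ m"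
      using c[of m] q0 mult_right_mono[of "c m + 1" q "q ^ m"] by (simp add: algebra_simps)
    moreover have "0 \<le> c m * q ^ m" using c[of m] q0 by simp
    ultimately show ?case using Suc.IH by simp
  qed simp
  have iff: "Zp_sums p (\<lambda>i. c i * q ^ i) x \<longleftrightarrow> (\<forall>m. x (k * m) = (\<Sum>i<m. c i * q ^ i))"
    if c: "\<And>i. 0 \<le> c i \<and> c i < q" for c
    using Zp_sums_digits_iff[OF p q, of c x] x bound[OF c] by (simp add: mod_pos_pos_trivial)
  define d where "d i = x (k * Suc i) div q ^ i" for i
  have d: "0 \<le> d i \<and> d i < q" for i
  proof
    have b: "0 \<le> x (k * Suc i)" "x (k * Suc i) < q * q ^ i"
      using x[unfolded carrier_Zp, rule_format, of "k * Suc i"] qm[of "Suc i"] by auto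
    show "0 \<le> d i" using b q0 by (simp add: d_def pos_imp_zdiv_nonneg_iff)
    show "d i < q"
    proof (rule ccontr)
      assume "\<not> d i < q"
      then have "q * q ^ i \<le> d i * q ^ i" using q0 by simp
      also have "\<dots> \<le> x (k * Suc i)"
      proof -
        have "0 \<le> x (k * Suc i) mod q ^ i" using q0 by simp
        then show ?thesis
          using div_mult_mod_eq[of "x (k * Suc i)" "q ^ i"] unfolding d_def by linarith
      qed
      finally show False using b by simp
    qed
  qed
  have "x (k * m) = (\<Sum>i<m. d i * q ^ i)" for m
  proof (induction m)
    case 0
    have "0 \<le> x 0" "x 0 < p ^ 0"
      using x unfolding carrier_Zp by blast+
    then show ?case by simp
  next
    case (Suc m)
    have "x (k * Suc m) mod q ^ m = x (k * m)"
      using Zp_mod_le[OF x, of "k * m" "k * Suc m"] by (simp add: qm)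
    then show ?case
      using div_mult_mod_eq[of "x (k * Suc m)" "q ^ m"] Suc.IH by (simp add: d_def)
  qed
  then have ex: "Zp_sums p (\<lambda>i. d i * q ^ i) x" using iff[OF d] by simp
  have uniq: "c = d" if c: "\<forall>i. 0 \<le> c i \<and> c i < q" and s: "Zp_sums p (\<lambda>i. c i * q ^ i) x" for c
  proof
    fix m
    have *: "(\<Sum>i<n. c i * q ^ i) = (\<Sum>i<n. d i * q ^ i)" for n
      using iff[of c] iff[of d] c d s ex by metis
    have "c m * q ^ m = d m * q ^ m"
      using *[of m] *[of "Suc m"] by simp
    then show "c m = d m" using q0 by simp
  qed
  show ?thesis
    by (rule ex1I[of _ d]) (use d ex uniq in auto)
qed

lemma permuted_sum_ex1:
  assumes p: "p > 1" and q: "q = p ^ k" "k \<ge> 1" and \<rho>: "inj \<rho>"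
  shows "\<exists>!y. Zp_sums p (\<lambda>i. c i * q ^ \<rho> i) y"
proof -
  have "\<exists>y. \<forall>\<^sub>F m in sequentially. (\<Sum>i<m. c i * q ^ \<rho> i) mod p ^ n = y" for n
  proof -
    have "finite (\<rho> -` {..<n})"
      using \<rho> by (intro finite_vimageI) auto
    then obtain N where N: "\<And>i. \<rho> i < n \<Longrightarrow> i < N"
      by (metis finite_nat_bounded lessThan_iff subset_iff vimageI)
    have "(\<Sum>i<m. c i * q ^ \<rho> i) mod p ^ n = (\<Sum>i<N. c i * q ^ \<rho> i) mod p ^ n" if "N \<le> m" for m
      using that
    proof (induction m rule: dec_induct)
      case (step m)
      have "n \<le> \<rho> m" using N[of m] step.hyps by force
      then have "n \<le> k * \<rho> m"
        using q(2) mult_le_mono[of 1 k n "\<rho> m"] by simp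
      then have "p ^ n dvd c m * q ^ \<rho> m"
        by (simp add: q le_imp_power_dvd flip: power_mult)
      then show ?case using step.IH by (simp add: mod_add_dvd)
    qed simp
    then show ?thesis
      unfolding eventually_sequentially by blast
  qed
  then obtain y where y: "\<And>n. \<forall>\<^sub>F m in sequentially. (\<Sum>i<m. c i * q ^ \<rho> i) mod p ^ n = y n"
    by metis
  have "0 \<le> y n \<and> y n < p ^ n \<and> y (Suc n) mod p ^ n = y n" for n
  proof -
    have "\<forall>\<^sub>F m in sequentially. 0 \<le> y n \<and> y n < p ^ n \<and> y (Suc n) mod p ^ n = y n"
      using y[of n] y[of "Suc n"]
    proof eventually_elim
      case (elim m)
      have "y (Suc n) mod p ^ n = y n"
        unfolding elim(1)[symmetric] elim(2)[symmetric] by (simp add: mod_mod_cancel)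
      moreover have "0 \<le> y n" "y n < p ^ n"
        unfolding elim(1)[symmetric] using p by simp_all
      ultimately show ?case by simp
    qed
    then show ?thesis by simp
  qed
  then have "Zp_sums p (\<lambda>i. c i * q ^ \<rho> i) y"
    using y p by (simp add: Zp_sums_iff carrier_Zp)
  then show ?thesis
    using Zp_sums_unique[of p] p by auto
qed

end

theory Submission
  imports Defs
begin

text \<open>
  Everything follows from one observation: if \<open>x\<close> has the \<open>q\<close>-adic digits \<open>c\<close>, then
  \<open>rho_star p q \<rho> x\<close> has the digits \<open>c \<circ> perm_inv \<rho>\<close> (\<open>rho_star_expansion\<close>).  Indeed, modulo
  \<open>p ^ n\<close> only the finitely many terms with \<open>\<rho> i < n\<close> of the series \<open>\<Sum>i. c i * q ^ \<rho> i\<close> survive,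
  so that the series may be rearranged into \<open>\<Sum>j. c (perm_inv \<rho> j) * q ^ j\<close>, and the expansion of an
  element is unique.  Each assertion then becomes a statement about digit sequences that is
  visibly invariant under a permutation of the indices:

  \<^item> the residue of \<open>rho_star p q \<rho> x\<close> modulo \<open>p ^ n\<close> depends on finitely many digits of \<open>x\<close>, hence
    on a single residue of \<open>x\<close>, which is continuity;

  \<^item> if there is no carry, then the digits of \<open>x + y\<close> are the sums of the digits of \<open>x\<close> and \<open>y\<close>;

  \<^item> the nonnegative integers are the elements with finitely many nonzero digits, and each of them
    is congruent to the sum of its digits modulo \<open>q - 1\<close>, because \<open>q ^ i\<close> is congruent to \<open>1\<close>;

  \<^item> complementing every digit, \<open>c i \<mapsto> q - 1 - c i\<close>, is the map \<open>x \<mapsto> -1 - x\<close>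
    (\<open>expansion_complement\<close>).  It commutes with permuting the digits and exchanges the
    nonnegative with the negative integers, so that the results for negative integers follow
    from those for nonnegative ones.

  For the setwise stability it is enough to show that every permutation of the digits maps the set
  into itself, because the inverse of such a map is again one.  Throughout, \<open>perm_inv \<rho>\<close> is the
  inverse of \<open>\<rho>\<close>.
\<close>

section \<open>Expansions\<close>

locale qadic =
  fixes p q :: int and k :: nat
  assumes p_gt_1: "p > 1" and k_ge_1: "k \<ge> 1" and q_eq: "q = p ^ k"
begin

definition expansion :: "(nat \<Rightarrow> int) \<Rightarrow> (nat \<Rightarrow> int) \<Rightarrow> bool" where
  "expansion c x \<longleftrightarrow> (\<forall>i. 0 \<le> c i \<and> c i < q) \<and> Zp_sums p (\<lambda>i. c i * q ^ i) x"

text \<open>A separate name, because the word \<open>inv\<close> is read as inversion in a group.\<close>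

abbreviation perm_inv :: "(nat \<Rightarrow> nat) \<Rightarrow> nat \<Rightarrow> nat" where
  "perm_inv \<equiv> inv_into UNIV"

lemma q_gt_1: "q > 1"
  using p_gt_1 k_ge_1 by (simp add: q_eq)

lemma q_power: "q ^ m = p ^ (k * m)"
  by (simp add: q_eq power_mult)

lemma p_power_dvd_q_power:
  assumes "n \<le> m"
  shows "p ^ n dvd q ^ m"
proof -
  have "n \<le> k * m"
    using assms k_ge_1 mult_le_mono[of 1 k n m] by simp
  then show ?thesis
    by (simp add: q_power le_imp_power_dvd)
qed

lemma expansion_bounds: "expansion c x \<Longrightarrow> 0 \<le> c i \<and> c i < q"
  by (simp add: expansion_def)

lemma expansion_iff:
  "expansion c x \<longleftrightarrow> (\<forall>i. 0 \<le> c i \<and> c i < q) \<and>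
     x \<in> carrier (Zp p) \<and> (\<forall>m. x (k * m) = (\<Sum>i<m. c i * q ^ i) mod q ^ m)"
  unfolding expansion_def Zp_sums_digits_iff[OF p_gt_1 q_eq k_ge_1] ..

lemma expansion_closed: "expansion c x \<Longrightarrow> x \<in> carrier (Zp p)"
  by (simp add: expansion_iff)

lemma expansion_qdigits:
  assumes "x \<in> carrier (Zp p)"
  shows "expansion (qdigits p q x) x"
  unfolding expansion_def qdigits_def
  by (rule theI'[OF qadic_expansion_ex1[OF p_gt_1 q_eq k_ge_1 assms]])

lemma qdigits_eqI:
  assumes "expansion c x"
  shows "qdigits p q x = c"
  using qadic_expansion_ex1[OF p_gt_1 q_eq k_ge_1 expansion_closed[OF assms]]
    expansion_qdigits[OF expansion_closed[OF assms]] assms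
  unfolding expansion_def by blast

lemma expansion_unique: "expansion c x \<Longrightarrow> expansion c y \<Longrightarrow> x = y"
  using Zp_sums_unique[of p] p_gt_1 unfolding expansion_def by auto

lemma partial_sum_bounds:
  assumes "\<And>i. 0 \<le> c i \<and> c i < q"
  shows "0 \<le> (\<Sum>i<m. c i * q ^ i) \<and> (\<Sum>i<m. c i * q ^ i) < q ^ m"
proof (induction m)
  case (Suc m)
  have "c m * q ^ m + q ^ m \<le> q * q ^ m"
    using assms[of m] q_gt_1 mult_right_mono[of "c m + 1" q "q ^ m"] by (simp add: algebra_simps)
  moreover have "0 \<le> c m * q ^ m"
    using assms[of m] q_gt_1 by simp
  ultimately show ?case
    using Suc.IH by simp
qed simp

lemma expansion_residue:
  assumes "expansion c x"
  shows "x (k * m) = (\<Sum>i<m. c i * q ^ i)"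
  using assms partial_sum_bounds[OF expansion_bounds[OF assms], where m = m]
  by (simp add: expansion_iff)

lemma expansion_add:
  assumes c: "expansion c x" and d: "expansion d y" and carry: "\<And>i. c i + d i \<le> q - 1"
  shows "expansion (\<lambda>i. c i + d i) (x \<oplus>\<^bsub>Zp p\<^esub> y)"
proof -
  have "x \<oplus>\<^bsub>Zp p\<^esub> y \<in> carrier (Zp p)"
  proof -
    interpret cring "Zp p"
      using cring_Zp p_gt_1 by simp
    show ?thesis
      using expansion_closed[OF c] expansion_closed[OF d] by (rule a_closed)
  qed
  moreover have "(x \<oplus>\<^bsub>Zp p\<^esub> y) (k * m) = (\<Sum>i<m. (c i + d i) * q ^ i) mod q ^ m" for m
    by (simp add: expansion_residue[OF c] expansion_residue[OF d] distrib_right sum.distrib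
        flip: q_power)
  moreover have "0 \<le> c i + d i \<and> c i + d i < q" for i
    using expansion_bounds[OF c, of i] expansion_bounds[OF d, of i] carry[of i] by simp
  ultimately show ?thesis
    unfolding expansion_iff by blast
qed


section \<open>Digits of integers\<close>

lemma expansion_finite:
  assumes "\<And>i. 0 \<le> c i \<and> c i < q" and "\<And>i. i \<ge> N \<Longrightarrow> c i = 0"
  shows "expansion c (Zp_of_int p (\<Sum>i<N. c i * q ^ i))"
proof -
  have "\<forall>\<^sub>F m in sequentially. (\<Sum>i<m. c i * q ^ i) = (\<Sum>i<N. c i * q ^ i)"
    using eventually_ge_at_top[of N]
  proof eventually_elim
    case (elim m)
    then show ?case
      using assms(2) by (intro sum.mono_neutral_right) auto
  qed
  then have "\<forall>\<^sub>F m in sequentially.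
      (\<Sum>i<m. c i * q ^ i) mod p ^ n = Zp_of_int p (\<Sum>i<N. c i * q ^ i) n" for n
    by eventually_elim (simp add: Zp_of_int_def)
  then show ?thesis
    using assms(1) p_gt_1 by (simp add: expansion_def Zp_sums_iff)
qed

text \<open>
  The residue modulo \<open>q ^ m\<close> truncates the expansion.  Continuity uses this to replace \<open>x\<close> by one
  of its residues, and the characterization of the nonnegative integers uses it because such an
  integer is equal to its residue for large \<open>m\<close>.
\<close>

lemma expansion_truncate:
  assumes "expansion c x"
  shows "expansion (\<lambda>i. if i < m then c i else 0) (Zp_of_int p (x (k * m)))"
proof -
  let ?c = "\<lambda>i. if i < m then c i else 0"
  have "expansion ?c (Zp_of_int p (\<Sum>i<m. ?c i * q ^ i))"
    using expansion_bounds[OF assms] q_gt_1 by (intro expansion_finite) auto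
  then show ?thesis
    by (simp add: expansion_residue[OF assms])
qed

lemma expansion_nonneg:
  assumes c: "expansion c (Zp_of_int p n)" and "n \<ge> 0"
  obtains m where "\<And>i. i \<ge> m \<Longrightarrow> c i = 0" "n = (\<Sum>i<m. c i * q ^ i)"
proof -
  define m where "m = nat n"
  \<comment> \<open>Any \<open>m\<close> with \<open>n < q ^ m\<close> would serve; \<open>m = n\<close> does, because \<open>n < 2 ^ n\<close>.\<close>
  have "n < q ^ m"
  proof -
    have "n < 2 ^ m"
      using \<open>n \<ge> 0\<close> of_nat_less_two_power[of m, where 'a = int] by (simp add: m_def)
    also have "\<dots> \<le> q ^ m"
      using q_gt_1 by (intro power_mono) auto
    finally show ?thesis .
  qed
  then have residue: "Zp_of_int p n (k * m) = n"
    using \<open>n \<ge> 0\<close> by (simp add: Zp_of_int_def flip: q_power)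
  have "c = (\<lambda>i. if i < m then c i else 0)"
    using qdigits_eqI[OF c] qdigits_eqI[OF expansion_truncate[OF c, of m]] residue by simp
  then have "c i = 0" if "i \<ge> m" for i
    using that by (metis not_less)
  then show ?thesis
    using that[of m] residue expansion_residue[OF c, of m] by metis
qed

lemma expansion_finite_support:
  assumes c: "expansion c x" and fin: "finite {i. c i \<noteq> 0}"
  obtains n where "n \<ge> 0" "x = Zp_of_int p n"
proof -
  obtain N where N: "{i. c i \<noteq> 0} \<subseteq> {..<N}"
    using finite_nat_bounded[OF fin] by blast
  then have "\<And>i. i \<ge> N \<Longrightarrow> c i = 0"
    by (meson lessThan_iff mem_Collect_eq not_less subsetD)
  then have "expansion c (Zp_of_int p (\<Sum>i<N. c i * q ^ i))"
    using expansion_bounds[OF c] by (intro expansion_finite)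
  then have "x = Zp_of_int p (\<Sum>i<N. c i * q ^ i)"
    by (rule expansion_unique[OF c])
  then show ?thesis
    using partial_sum_bounds[OF expansion_bounds[OF c], where m = N] by (intro that) auto
qed

text \<open>
  The number with all digits equal to \<open>q - 1\<close> is \<open>-1\<close>, because \<open>\<Sum>i<m. (q - 1) * q ^ i\<close> is
  \<open>q ^ m - 1\<close>; subtracting from it needs no borrowing.
\<close>

lemma expansion_complement:
  assumes c: "expansion c (Zp_of_int p n)"
  shows "expansion (\<lambda>i. q - 1 - c i) (Zp_of_int p (- 1 - n))"
proof -
  have "0 \<le> q - 1 - c i \<and> q - 1 - c i < q" for i
    using expansion_bounds[OF c, of i] by simp
  moreover have "Zp_of_int p (- 1 - n) (k * m) = (\<Sum>i<m. (q - 1 - c i) * q ^ i) mod q ^ m" for m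
  proof -
    have geometric: "(\<Sum>i<m. (q - 1) * q ^ i) = q ^ m - 1"
      by (simp add: power_diff_1_eq sum_distrib_left)
    have "(\<Sum>i<m. (q - 1 - c i) * q ^ i) = (\<Sum>i<m. (q - 1) * q ^ i) - (\<Sum>i<m. c i * q ^ i)"
      by (simp add: left_diff_distrib sum_subtractf)
    also have "\<dots> = q ^ m + (- 1 - n mod q ^ m)"
      unfolding geometric expansion_residue[OF c, symmetric]
      by (simp add: Zp_of_int_def q_power)
    also have "\<dots> mod q ^ m = (- 1 - n) mod q ^ m"
      by (simp add: mod_diff_right_eq)
    finally show ?thesis
      by (simp add: Zp_of_int_def q_power)
  qed
  ultimately show ?thesis
    using p_gt_1 by (simp add: expansion_iff)
qed

lemma cong_digit_sum:
  "[int n = digit_sum p q n] (mod (q - 1))"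
proof -
  define c where "c = qdigits p q (Zp_of_int p (int n))"
  have "expansion c (Zp_of_int p (int n))"
    unfolding c_def using p_gt_1 by (intro expansion_qdigits) simp
  then obtain m where m: "\<And>i. i \<ge> m \<Longrightarrow> c i = 0" and n: "int n = (\<Sum>i<m. c i * q ^ i)"
    by (rule expansion_nonneg) auto
  have "digit_sum p q n = (\<Sum>i<m. c i)"
    unfolding digit_sum_def c_def[symmetric]
    using m by (intro sum.mono_neutral_left) (auto simp: not_less[symmetric])
  moreover have "[(\<Sum>i<m. c i * q ^ i) = (\<Sum>i<m. c i * 1 ^ i)] (mod (q - 1))"
    by (intro cong_sum cong_mult cong_refl cong_pow) (simp add: cong_iff_dvd_diff)
  ultimately show ?thesis
    by (simp add: n)
qed


section \<open>Permuting digits\<close>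

text \<open>
  Modulo \<open>p ^ n\<close> every term with \<open>\<rho> i \<ge> n\<close> vanishes; the other terms are indexed by
  \<open>perm_inv \<rho> ` {..<n}\<close>, and occur in every sufficiently long partial sum.
\<close>

lemma permuted_sum_mod:
  assumes "bij \<rho>"
  shows "\<forall>\<^sub>F m in sequentially.
    (\<Sum>i<m. c i * q ^ \<rho> i) mod p ^ n = (\<Sum>j<n. c (perm_inv \<rho> j) * q ^ j) mod p ^ n"
proof -
  have [simp]: "\<rho> (perm_inv \<rho> j) = j" "perm_inv \<rho> (\<rho> j) = j" for j
    using assms by (simp_all add: bij_is_inj bij_is_surj surj_f_inv_f)
  obtain N where N: "perm_inv \<rho> ` {..<n} \<subseteq> {..<N}"
    using finite_nat_bounded[of "perm_inv \<rho> ` {..<n}"] by blast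
  show ?thesis
    using eventually_ge_at_top[of N]
  proof eventually_elim
    case (elim m)
    let ?f = "\<lambda>i. c i * q ^ \<rho> i"
    have "perm_inv \<rho> ` {..<n} \<subseteq> {..<m}"
      using N elim by force
    then have "sum ?f {..<m} = sum ?f (perm_inv \<rho> ` {..<n}) + sum ?f ({..<m} - perm_inv \<rho> ` {..<n})"
      by (simp add: sum.subset_diff add.commute)
    moreover have "p ^ n dvd sum ?f ({..<m} - perm_inv \<rho> ` {..<n})"
    proof (intro dvd_sum dvd_mult p_power_dvd_q_power)
      fix i
      assume "i \<in> {..<m} - perm_inv \<rho> ` {..<n}"
      then show "n \<le> \<rho> i"
        by (metis Diff_iff \<open>\<And>j. perm_inv \<rho> (\<rho> j) = j\<close> image_eqI lessThan_iff not_less)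
    qed
    moreover have "sum ?f (perm_inv \<rho> ` {..<n}) = (\<Sum>j<n. c (perm_inv \<rho> j) * q ^ j)"
      using assms by (simp add: sum.reindex inj_on_subset[OF bij_is_inj[OF bij_imp_bij_inv]])
    ultimately show ?case
      by (simp add: mod_add_dvd)
  qed
qed

lemma Zp_sums_permuted_iff:
  assumes "bij \<rho>"
  shows "Zp_sums p (\<lambda>i. c i * q ^ \<rho> i) y \<longleftrightarrow>
    y \<in> carrier (Zp p) \<and> (\<forall>n. y n = (\<Sum>j<n. c (perm_inv \<rho> j) * q ^ j) mod p ^ n)"
proof -
  have "(\<forall>\<^sub>F m in sequentially. (\<Sum>i<m. c i * q ^ \<rho> i) mod p ^ n = y n) \<longleftrightarrow>
      y n = (\<Sum>j<n. c (perm_inv \<rho> j) * q ^ j) mod p ^ n" (is "?L \<longleftrightarrow> ?R") for n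
  proof -
    have "?L \<longleftrightarrow> (\<forall>\<^sub>F m in sequentially. ?R)"
      using permuted_sum_mod[OF assms, of c n] by (rule eventually_subst[OF eventually_mono]) auto
    then show ?thesis
      by simp
  qed
  then show ?thesis
    using p_gt_1 by (simp add: Zp_sums_iff)
qed

lemma rho_star_sums:
  assumes "bij \<rho>"
  shows "Zp_sums p (\<lambda>i. qdigits p q x i * q ^ \<rho> i) (rho_star p q \<rho> x)"
  unfolding rho_star_def Zp_suminf_def
  by (rule theI'[OF permuted_sum_ex1[OF p_gt_1 q_eq k_ge_1 bij_is_inj[OF assms]]])

lemma rho_star_closed: "bij \<rho> \<Longrightarrow> rho_star p q \<rho> x \<in> carrier (Zp p)"
  using rho_star_sums[of \<rho> x] by (simp add: Zp_sums_permuted_iff)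

lemma rho_star_residue:
  assumes "bij \<rho>"
  shows "rho_star p q \<rho> x n = (\<Sum>j<n. qdigits p q x (perm_inv \<rho> j) * q ^ j) mod p ^ n"
  using rho_star_sums[OF assms, of x] assms by (simp add: Zp_sums_permuted_iff)

text \<open>
  The criterion \<open>Zp_sums_permuted_iff\<close> depends on the digit sequence and the permutation only
  through \<open>c \<circ> perm_inv \<rho>\<close>, so that the permuted series for \<open>c\<close> and the ordinary series for
  \<open>c \<circ> perm_inv \<rho>\<close> have the same sum.
\<close>

lemma rho_star_expansion:
  assumes \<rho>: "bij \<rho>" and c: "expansion c x"
  shows "expansion (c \<circ> perm_inv \<rho>) (rho_star p q \<rho> x)"
proof -
  \<comment> \<open>Writing \<open>id j\<close> for the exponent makes the criterion apply to the ordinary series as well.\<close>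
  have "Zp_sums p (\<lambda>j. (c \<circ> perm_inv \<rho>) j * q ^ id j) (rho_star p q \<rho> x)"
    using rho_star_sums[OF \<rho>, of x] \<rho>
    by (simp only: Zp_sums_permuted_iff bij_id qdigits_eqI[OF c]) simp
  then show ?thesis
    using expansion_bounds[OF c] by (simp add: expansion_def)
qed

lemma rho_star_inv:
  assumes \<rho>: "bij \<rho>" and x: "x \<in> carrier (Zp p)"
  shows "rho_star p q \<rho> (rho_star p q (perm_inv \<rho>) x) = x"
proof -
  note c = expansion_qdigits[OF x]
  have "expansion ((qdigits p q x \<circ> perm_inv (perm_inv \<rho>)) \<circ> perm_inv \<rho>)
      (rho_star p q \<rho> (rho_star p q (perm_inv \<rho>) x))"
    by (intro rho_star_expansion \<rho> bij_imp_bij_inv c)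
  then have "expansion (qdigits p q x) (rho_star p q \<rho> (rho_star p q (perm_inv \<rho>) x))"
    using \<rho> by (simp add: inv_inv_eq comp_assoc surj_iff[THEN iffD1] bij_is_surj)
  then show ?thesis
    using expansion_unique c by blast
qed

lemma rho_star_image_eqI:
  assumes closed: "\<And>\<sigma>. bij \<sigma> \<Longrightarrow> rho_star p q \<sigma> ` A \<subseteq> A"
    and A: "A \<subseteq> carrier (Zp p)" and \<rho>: "bij \<rho>"
  shows "rho_star p q \<rho> ` A = A"
proof
  show "A \<subseteq> rho_star p q \<rho> ` A"
  proof
    fix x assume "x \<in> A"
    then have "rho_star p q (perm_inv \<rho>) x \<in> A"
      using closed[OF bij_imp_bij_inv[OF \<rho>]] by blast
    then show "x \<in> rho_star p q \<rho> ` A"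
      using rho_star_inv[OF \<rho>, of x] A \<open>x \<in> A\<close> by (metis image_eqI subsetD)
  qed
qed (rule closed[OF \<rho>])


section \<open>Continuity and additivity\<close>

lemma continuous_rho_star:
  assumes \<rho>: "bij \<rho>"
  shows "continuous_map (Zp_topology p) (Zp_topology p) (rho_star p q \<rho>)"
proof -
  have "continuous_map (Zp_topology p) (discrete_topology {0..<p ^ n}) (\<lambda>x. rho_star p q \<rho> x n)"
    for n
  proof -
    obtain m where m: "perm_inv \<rho> ` {..<n} \<subseteq> {..<m}"
      using finite_nat_bounded[of "perm_inv \<rho> ` {..<n}"] by blast
    \<comment> \<open>The residue modulo \<open>p ^ n\<close> of the image involves only the first \<open>m\<close> digits of \<open>x\<close>.  These
      are also the first \<open>m\<close> digits of the integer \<open>x (k * m)\<close>, so that it is the function \<open>g\<close> of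
      that residue, and every function between discrete spaces is continuous.\<close>
    define g where "g t = rho_star p q \<rho> (Zp_of_int p t) n" for t
    have "continuous_map (Zp_topology p) (discrete_topology {0..<p ^ (k * m)}) (\<lambda>x. x (k * m))"
      unfolding Zp_topology_def
      by (intro continuous_map_from_subtopology continuous_map_product_projection) simp
    moreover have "continuous_map (discrete_topology {0..<p ^ (k * m)})
        (discrete_topology {0..<p ^ n}) g"
      using rho_star_closed[OF \<rho>] by (auto simp: g_def carrier_Zp)
    ultimately have "continuous_map (Zp_topology p) (discrete_topology {0..<p ^ n})
        (g \<circ> (\<lambda>x. x (k * m)))"
      by (rule continuous_map_compose)
    moreover have "(g \<circ> (\<lambda>x. x (k * m))) x = rho_star p q \<rho> x n"
      if "x \<in> topspace (Zp_topology p)" for x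
    proof -
      have "expansion (qdigits p q x) x"
        using that by (simp add: expansion_qdigits)
      from qdigits_eqI[OF expansion_truncate[OF this, of m]] show ?thesis
        using m by (auto simp: g_def rho_star_residue[OF \<rho>] image_subset_iff
            intro!: arg_cong[where f = "\<lambda>s. s mod p ^ n"] sum.cong)
    qed
    ultimately show ?thesis
      by (rule continuous_map_eq)
  qed
  then have "continuous_map (Zp_topology p) (product_topology (\<lambda>n. discrete_topology {0..<p ^ n}) UNIV)
      (rho_star p q \<rho>)"
    by (simp add: continuous_map_componentwise_UNIV)
  then have "continuous_map (Zp_topology p)
      (subtopology (product_topology (\<lambda>n. discrete_topology {0..<p ^ n}) UNIV) (carrier (Zp p)))
      (rho_star p q \<rho>)"
    using rho_star_closed[OF \<rho>] by (intro continuous_map_into_subtopology) auto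
  then show ?thesis
    by (simp only: Zp_topology_def)
qed

lemma rho_star_add:
  assumes \<rho>: "bij \<rho>" and x: "x \<in> carrier (Zp p)" and y: "y \<in> carrier (Zp p)"
    and carry: "no_carry p q x y"
  shows "rho_star p q \<rho> (x \<oplus>\<^bsub>Zp p\<^esub> y) = rho_star p q \<rho> x \<oplus>\<^bsub>Zp p\<^esub> rho_star p q \<rho> y"
proof -
  define c d where "c = qdigits p q x" and "d = qdigits p q y"
  have c: "expansion c x" and d: "expansion d y"
    using x y by (simp_all add: c_def d_def expansion_qdigits)
  have le: "c i + d i \<le> q - 1" for i
    using carry by (simp add: no_carry_def c_def d_def)
  have "expansion ((\<lambda>i. c i + d i) \<circ> perm_inv \<rho>) (rho_star p q \<rho> (x \<oplus>\<^bsub>Zp p\<^esub> y))"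
    by (intro rho_star_expansion[OF \<rho>] expansion_add c d le)
  moreover have "expansion (\<lambda>i. (c \<circ> perm_inv \<rho>) i + (d \<circ> perm_inv \<rho>) i)
      (rho_star p q \<rho> x \<oplus>\<^bsub>Zp p\<^esub> rho_star p q \<rho> y)"
    using le by (intro expansion_add rho_star_expansion[OF \<rho>] c d) simp
  ultimately show ?thesis
    using expansion_unique by (simp add: comp_def)
qed


section \<open>Permuting the digits of integers\<close>

lemma rho_star_nonneg:
  assumes \<rho>: "bij \<rho>" and "n \<ge> 0"
  obtains m where "m \<ge> 0" "rho_star p q \<rho> (Zp_of_int p n) = Zp_of_int p m"
proof -
  define c where "c = qdigits p q (Zp_of_int p n)"
  have c: "expansion c (Zp_of_int p n)"
    unfolding c_def using p_gt_1 by (intro expansion_qdigits) simp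
  obtain N where "\<And>i. i \<ge> N \<Longrightarrow> c i = 0"
    using expansion_nonneg[OF c \<open>n \<ge> 0\<close>] by blast
  then have "{i. c i \<noteq> 0} \<subseteq> {..<N}"
    by (auto simp: not_less[symmetric])
  then have "finite (perm_inv \<rho> -` {i. c i \<noteq> 0})"
    using bij_is_inj[OF bij_imp_bij_inv[OF \<rho>]] by (intro finite_vimageI) (rule finite_subset, auto)
  then have "finite {j. (c \<circ> perm_inv \<rho>) j \<noteq> 0}"
    by (simp add: vimage_def)
  then show ?thesis
    using that by (rule expansion_finite_support[OF rho_star_expansion[OF \<rho> c]])
qed

lemma rho_star_complement:
  assumes \<rho>: "bij \<rho>" and m: "rho_star p q \<rho> (Zp_of_int p n) = Zp_of_int p m"
  shows "rho_star p q \<rho> (Zp_of_int p (- 1 - n)) = Zp_of_int p (- 1 - m)"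
proof -
  define c where "c = qdigits p q (Zp_of_int p n)"
  have c: "expansion c (Zp_of_int p n)"
    unfolding c_def using p_gt_1 by (intro expansion_qdigits) simp
  have "expansion ((\<lambda>i. q - 1 - c i) \<circ> perm_inv \<rho>) (rho_star p q \<rho> (Zp_of_int p (- 1 - n)))"
    by (intro rho_star_expansion[OF \<rho>] expansion_complement c)
  moreover have "expansion (\<lambda>i. q - 1 - (c \<circ> perm_inv \<rho>) i) (Zp_of_int p (- 1 - m))"
    using rho_star_expansion[OF \<rho> c] unfolding m by (rule expansion_complement)
  ultimately show ?thesis
    using expansion_unique by (simp add: comp_def)
qed

lemma rho_star_digit_sum:
  assumes \<rho>: "bij \<rho>" and m: "rho_star p q \<rho> (Zp_of_int p (int n)) = Zp_of_int p (int m)"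
  shows "digit_sum p q n = digit_sum p q m"
proof -
  define c where "c = qdigits p q (Zp_of_int p (int n))"
  have "expansion c (Zp_of_int p (int n))"
    unfolding c_def using p_gt_1 by (intro expansion_qdigits) simp
  from qdigits_eqI[OF rho_star_expansion[OF \<rho> this]]
  have d: "qdigits p q (Zp_of_int p (int m)) = c \<circ> perm_inv \<rho>"
    by (simp add: m)
  have "bij_betw (perm_inv \<rho>) {j. c (perm_inv \<rho> j) \<noteq> 0} {i. c i \<noteq> 0}"
    using \<rho> by (intro bij_betwI[where g = \<rho>])
      (auto simp: bij_is_inj bij_is_surj surj_f_inv_f)
  from sum.reindex_bij_betw[OF this, of c] show ?thesis
    by (simp add: digit_sum_def d flip: c_def)
qed

lemma rho_star_nonneg_cong:
  assumes \<rho>: "bij \<rho>" and "n \<ge> 0"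
  obtains m where "m \<ge> 0" "rho_star p q \<rho> (Zp_of_int p n) = Zp_of_int p m" "[n = m] (mod (q - 1))"
proof -
  obtain m where "m \<ge> 0" and m: "rho_star p q \<rho> (Zp_of_int p n) = Zp_of_int p m"
    using rho_star_nonneg[OF assms] by blast
  then have "digit_sum p q (nat n) = digit_sum p q (nat m)"
    using \<open>n \<ge> 0\<close> by (intro rho_star_digit_sum[OF \<rho>]) simp
  then have "[n = m] (mod (q - 1))"
    using cong_digit_sum[of "nat n"] cong_digit_sum[of "nat m"] \<open>n \<ge> 0\<close> \<open>m \<ge> 0\<close>
    by (simp add: cong_def)
  then show ?thesis
    using that \<open>m \<ge> 0\<close> m by blast
qed

text \<open>
  With \<open>n = -1 - n'\<close> the image is \<open>-1 - m'\<close>, where \<open>m'\<close> is the image of the nonnegative integer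
  \<open>n'\<close>; the map \<open>x \<mapsto> -1 - x\<close> respects congruences.
\<close>

lemma rho_star_neg_cong:
  assumes \<rho>: "bij \<rho>" and "n < 0"
  obtains m where "m < 0" "rho_star p q \<rho> (Zp_of_int p n) = Zp_of_int p m" "[n = m] (mod (q - 1))"
proof -
  obtain m where "m \<ge> 0" and m: "rho_star p q \<rho> (Zp_of_int p (- 1 - n)) = Zp_of_int p m"
    and cong: "[- 1 - n = m] (mod (q - 1))"
    using rho_star_nonneg_cong[OF \<rho>, of "- 1 - n"] \<open>n < 0\<close> by auto
  have "[n = - 1 - m] (mod (q - 1))"
    using cong_diff[OF cong_refl[of "- 1"] cong] by simp
  then show ?thesis
    using that[of "- 1 - m"] rho_star_complement[OF \<rho> m] \<open>m \<ge> 0\<close> by simp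
qed

lemma rho_star_int_cong:
  assumes "bij \<rho>"
  shows "\<exists>m. rho_star p q \<rho> (Zp_of_int p n) = Zp_of_int p m \<and> [n = m] (mod (q - 1))"
proof (cases "n \<ge> 0")
  case True
  then show ?thesis
    using rho_star_nonneg_cong[OF assms] by blast
next
  case False
  then show ?thesis
    using rho_star_neg_cong[OF assms, of n] by auto
qed

lemma rho_star_image_nonneg:
  assumes "bij \<rho>"
  shows "rho_star p q \<rho> ` Zp_of_int p ` {0..} = Zp_of_int p ` {0..}"
proof (rule rho_star_image_eqI[OF _ _ assms])
  fix \<sigma> :: "nat \<Rightarrow> nat"
  assume "bij \<sigma>"
  then show "rho_star p q \<sigma> ` Zp_of_int p ` {0..} \<subseteq> Zp_of_int p ` {0..}"
    using rho_star_nonneg by (fastforce simp: image_subset_iff)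
qed (use p_gt_1 in auto)

lemma rho_star_image_neg:
  assumes "bij \<rho>"
  shows "rho_star p q \<rho> ` Zp_of_int p ` {..<0} = Zp_of_int p ` {..<0}"
proof (rule rho_star_image_eqI[OF _ _ assms])
  fix \<sigma> :: "nat \<Rightarrow> nat"
  assume "bij \<sigma>"
  then show "rho_star p q \<sigma> ` Zp_of_int p ` {..<0} \<subseteq> Zp_of_int p ` {..<0}"
    using rho_star_neg_cong by (fastforce simp: image_subset_iff)
qed (use p_gt_1 in auto)

end


section \<open>Properties of the digit permutation\<close>

theorem proposition4:
  fixes p q :: int and k :: nat and \<rho> :: "nat \<Rightarrow> nat"
  assumes "prime p" and "k \<ge> 1" and "q = p ^ k" and "bij \<rho>"
  shows
    "continuous_map (Zp_topology p) (Zp_topology p) (rho_star p q \<rho>) \<and>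
     (\<forall>x \<in> carrier (Zp p). \<forall>y \<in> carrier (Zp p). \<forall>z \<in> carrier (Zp p).
        z = x \<oplus>\<^bsub>Zp p\<^esub> y \<and> no_carry p q x y \<longrightarrow>
        rho_star p q \<rho> z = rho_star p q \<rho> x \<oplus>\<^bsub>Zp p\<^esub> rho_star p q \<rho> y) \<and>
     rho_star p q \<rho> ` Zp_of_int p ` {0..} = Zp_of_int p ` {0..} \<and>
     rho_star p q \<rho> ` Zp_of_int p ` {..<0} = Zp_of_int p ` {..<0} \<and>
     (\<forall>n::nat. \<exists>m::nat. rho_star p q \<rho> (Zp_of_int p (int n)) = Zp_of_int p (int m) \<and>
        digit_sum p q n = digit_sum p q m) \<and>
     (\<forall>n::int. \<exists>m::int. rho_star p q \<rho> (Zp_of_int p n) = Zp_of_int p m \<and>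
        [n = m] (mod (q - 1)))"
proof -
  interpret qadic p q k
    using assms prime_gt_1_int by unfold_locales auto
  have "\<exists>m::nat. rho_star p q \<rho> (Zp_of_int p (int n)) = Zp_of_int p (int m) \<and>
      digit_sum p q n = digit_sum p q m" for n
  proof -
    obtain m where "m \<ge> 0" and "rho_star p q \<rho> (Zp_of_int p (int n)) = Zp_of_int p m"
      using rho_star_nonneg[OF \<open>bij \<rho>\<close>, of "int n"] by auto
    then have "rho_star p q \<rho> (Zp_of_int p (int n)) = Zp_of_int p (int (nat m))"
      by simp
    then show ?thesis
      using rho_star_digit_sum[OF \<open>bij \<rho>\<close>] by blast
  qed
  then show ?thesis
    using continuous_rho_star[OF \<open>bij \<rho>\<close>] rho_star_add[OF \<open>bij \<rho>\<close>]
      rho_star_image_nonneg[OF \<open>bij \<rho>\<close>] rho_star_image_neg[OF \<open>bij \<rho>\<close>]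
      rho_star_int_cong[OF \<open>bij \<rho>\<close>]
    by blast
qed

end
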